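(* Suppose that $X$ is a metric tree and $Y$ is an injective metric space. If $R \subset X \times Y$ is a set with the property that $\pi_X(R)$ strictly spans $X$, then there exists an extension $R \subset \bar R \subset X \times Y$ such that $\pi_X(\bar R) = X$ and $\operatorname{dis}(\bar R) = \operatorname{dis}(R)$.
   Context: The distance of two points $x,x'$ in a metric space is written $|xx'|$. A metric space $X$ is called geodesic if for every pair of points $x,x' \in X$ there is a geodesic segment $xx' \subset X$ connecting them, i.e., the image of an isometric embedding of the interval $[0,|xx'|]$ into $X$ that sends $0$ to $x$ and $|xx'|$ to $x'$. A metric tree is a geodesic metric space $X$ such that for any triple $(x,y,z)$ of points in $X$ and any geodesic segments $xy,xz,yz$ connecting them, $xy \subset xz \cup yz$. (No completeness is assumed.) A metric space $Y$ is called injective if for any isometric embedding $i \colon A \to B$ of metric spaces and any $1$-Lipschitz (distance-nonincreasing) map $f \colon A \to Y$ there exists a $1$-Lipschitz map $g \colon B \to Y$ with $g \circ i = f$. For a relation $R \subset X \times Y$ between metric spaces $X,Y$, the distortion of $R$ is the (possibly infinite) number \[ \operatorname{dis}(R) := \sup\bigl\{ \bigl| |xx'| - |yy'| \bigr| : (x,y), (x',y') \in R \bigr\}. \] The map $\pi_X \colon X \times Y \to X$ is the canonical projection. A subset $A$ of a metric space $X$ strictly spans $X$ if for every pair $(x,x') \in X \times X$ there exists an $a \in A$ such that $|xx'| + |x'a| = |xa|$. *)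

theory Defs
  imports "HOL-Analysis.Analysis"
begin

definition isometric_embedding :: "'a metric \<Rightarrow> 'b metric \<Rightarrow> ('a \<Rightarrow> 'b) \<Rightarrow> bool" where
  "isometric_embedding A B i \<longleftrightarrow>
     i \<in> mspace A \<rightarrow> mspace B \<and>
     (\<forall>x\<in>mspace A. \<forall>y\<in>mspace A. mdist B (i x) (i y) = mdist A x y)"

definition geodesic_segment :: "'a metric \<Rightarrow> 'a \<Rightarrow> 'a \<Rightarrow> 'a set \<Rightarrow> bool" where
  "geodesic_segment X x x' S \<longleftrightarrow>
     (\<exists>\<gamma>. isometric_embedding (submetric euclidean_metric {0..mdist X x x'}) X \<gamma> \<and>
          \<gamma> 0 = x \<and> \<gamma> (mdist X x x') = x' \<and> S = \<gamma> ` {0..mdist X x x'})"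

definition geodesic_metric :: "'a metric \<Rightarrow> bool" where
  "geodesic_metric X \<longleftrightarrow> (\<forall>x\<in>mspace X. \<forall>x'\<in>mspace X. \<exists>S. geodesic_segment X x x' S)"

definition metric_tree :: "'a metric \<Rightarrow> bool" where
  "metric_tree X \<longleftrightarrow> geodesic_metric X \<and>
     (\<forall>x\<in>mspace X. \<forall>y\<in>mspace X. \<forall>z\<in>mspace X. \<forall>Sxy Sxz Syz.
        geodesic_segment X x y Sxy \<longrightarrow> geodesic_segment X x z Sxz \<longrightarrow>
        geodesic_segment X y z Syz \<longrightarrow> Sxy \<subseteq> Sxz \<union> Syz)"

definition one_Lipschitz_map :: "'a metric \<Rightarrow> 'b metric \<Rightarrow> ('a \<Rightarrow> 'b) \<Rightarrow> bool" where
  "one_Lipschitz_map A B f \<longleftrightarrow>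
     f \<in> mspace A \<rightarrow> mspace B \<and>
     (\<forall>x\<in>mspace A. \<forall>y\<in>mspace A. mdist B (f x) (f y) \<le> mdist A x y)"

text \<open>
  A definition in HOL cannot quantify over all types, so the test spaces \<open>A\<close> and \<open>B\<close> range over
  the metric spaces whose points are taken from the type \<open>'y option\<close>. This loses nothing: by
  \<open>injective_metric_extend\<close> below, the property implies the extension property for metric spaces
  \<open>A\<close> and \<open>B\<close> over arbitrary types \<open>'a\<close> and \<open>'b\<close>.
\<close>

definition injective_metric :: "'y metric \<Rightarrow> bool" where
  "injective_metric Y \<longleftrightarrow>
     (\<forall>(A :: 'y option metric) (B :: 'y option metric) i f.
        isometric_embedding A B i \<and> one_Lipschitz_map A Y f \<longrightarrow>
        (\<exists>g. one_Lipschitz_map B Y g \<and> (\<forall>a\<in>mspace A. g (i a) = f a)))"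

lemma injective_metric_nonempty:
  fixes Y :: "'y metric"
  assumes "injective_metric Y"
  shows "mspace Y \<noteq> {}"
proof -
  define A where "A = metric ({} :: 'y option set, \<lambda>_ _. 0 :: real)"
  define B where "B = metric ({None} :: 'y option set, \<lambda>_ _. 0 :: real)"
  have "Metric_space ({} :: 'y option set) (\<lambda>_ _. 0 :: real)"
    by unfold_locales auto
  then have A: "mspace A = {}" by (simp add: A_def Metric_space.mspace_metric)
  have "Metric_space ({None} :: 'y option set) (\<lambda>_ _. 0 :: real)"
    by unfold_locales auto
  then have B: "mspace B = {None}" by (simp add: B_def Metric_space.mspace_metric)
  have "isometric_embedding A B id" "one_Lipschitz_map A Y (\<lambda>_. undefined)"
    by (auto simp: isometric_embedding_def one_Lipschitz_map_def A)
  then obtain g where "one_Lipschitz_map B Y g"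
    using assms unfolding injective_metric_def by blast
  then have "g None \<in> mspace Y" by (auto simp: one_Lipschitz_map_def B)
  then show ?thesis by blast
qed

lemma injective_metric_balls:
  fixes Y :: "'y metric"
  assumes inj: "injective_metric Y"
    and K: "K \<subseteq> mspace Y \<times> UNIV"
    and le: "\<And>c r c' r'. (c, r) \<in> K \<Longrightarrow> (c', r') \<in> K \<Longrightarrow> mdist Y c c' \<le> r + r'"
  shows "\<exists>y\<in>mspace Y. \<forall>(c, r)\<in>K. mdist Y c y \<le> r"
proof (cases "K = {}")
  case True
  then show ?thesis using injective_metric_nonempty[OF inj] by auto
next
  case False
  interpret Y: Metric_space "mspace Y" "mdist Y" by simp
  have r0: "0 \<le> r" if "(c, r) \<in> K" for c r
    using le[OF that that] K that by auto
  define s where "s y = (INF (c, r)\<in>K. r + mdist Y c y)" for y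
  have bdd: "bdd_below ((\<lambda>(c, r). r + mdist Y c y) ` K)" for y
    by (rule bdd_belowI[where m = 0]) (auto dest: r0 intro: add_nonneg_nonneg)
  have s_le: "s y \<le> r + mdist Y c y" if "(c, r) \<in> K" for y c r
    unfolding s_def using cINF_lower[OF bdd that] by simp
  have s_ge: "a \<le> s y" if "\<And>c r. (c, r) \<in> K \<Longrightarrow> a \<le> r + mdist Y c y" for a y
    unfolding s_def by (rule cINF_greatest[OF False]) (use that in auto)
  have s0: "0 \<le> s y" for y
    by (rule s_ge) (auto dest: r0 intro: add_nonneg_nonneg)
  have lip: "s y \<le> s y' + mdist Y y y'" if "y \<in> mspace Y" "y' \<in> mspace Y" for y y'
  proof -
    have "s y - mdist Y y y' \<le> s y'"
    proof (rule s_ge)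
      fix c r assume cr: "(c, r) \<in> K"
      then have "c \<in> mspace Y" using K by auto
      then have "mdist Y c y \<le> mdist Y c y' + mdist Y y y'"
        using that Y.triangle[of c y' y] Y.commute[of y y'] by simp
      then show "s y - mdist Y y y' \<le> r + mdist Y c y'" using s_le[OF cr, of y] by simp
    qed
    then show ?thesis by simp
  qed
  have lip': "s y \<le> s y' + mdist Y y' y" "s y \<le> mdist Y y y' + s y'"
    if "y \<in> mspace Y" "y' \<in> mspace Y" for y y'
    using lip[OF that] Y.commute[of y y'] by simp_all
  have s_c: "mdist Y c y \<le> r + s y" if cr: "(c, r) \<in> K" and y: "y \<in> mspace Y" for c r y
  proof -
    have "mdist Y c y - r \<le> s y"
    proof (rule s_ge)
      fix c' r' assume cr': "(c', r') \<in> K"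
      then have "mdist Y c y \<le> mdist Y c c' + mdist Y c' y"
        using Y.triangle[of c c' y] y cr K by auto
      then show "mdist Y c y - r \<le> r' + mdist Y c' y" using le[OF cr cr'] by simp
    qed
    then show ?thesis by simp
  qed
  have sum: "mdist Y y y' \<le> s y + s y'" if y: "y \<in> mspace Y" "y' \<in> mspace Y" for y y'
  proof -
    have "mdist Y y y' - s y' \<le> s y"
    proof (rule s_ge)
      fix c r assume cr: "(c, r) \<in> K"
      then have "c \<in> mspace Y" using K by auto
      then have "mdist Y y y' \<le> mdist Y c y + mdist Y c y'"
        using y Y.triangle[of y c y'] Y.commute[of c y] by simp
      then show "mdist Y y y' - s y' \<le> r + mdist Y c y" using s_c[OF cr y(2)] by simp
    qed
    then show ?thesis by simp
  qed
  show ?thesis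
  proof (cases "\<exists>y\<in>mspace Y. s y = 0")
    case True
    then obtain y where y: "y \<in> mspace Y" "s y = 0" by auto
    then have "\<forall>(c, r)\<in>K. mdist Y c y \<le> r" using s_c[of _ _ y] by auto
    then show ?thesis using y(1) by blast
  next
    case False
    then have pos: "0 < s y" if "y \<in> mspace Y" for y
      using s0[of y] that by force
    define d where "d p q = (case (p, q) of (Some y, Some y') \<Rightarrow> mdist Y y y'
      | (Some y, None) \<Rightarrow> s y | (None, Some y') \<Rightarrow> s y' | (None, None) \<Rightarrow> 0)" for p q
    define M where "M = insert None (Some ` mspace Y)"
    have MS: "Metric_space M d"
    proof
      show "0 \<le> d x y" for x y by (auto simp: d_def s0 split: option.splits)
      show "d x y = d y x" for x y by (auto simp: d_def Y.commute split: option.splits)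
      show "d x y = 0 \<longleftrightarrow> x = y" if "x \<in> M" "y \<in> M" for x y
        using that by (auto simp: d_def M_def dest: pos)
      show "d x z \<le> d x y + d y z" if "x \<in> M" "y \<in> M" "z \<in> M" for x y z
        using that
        by (auto simp: d_def M_def Y.triangle sum s0 lip' split: option.splits)
    qed
    define B where "B = metric (M, d)"
    have B: "mspace B = M" "mdist B = d"
      using MS by (simp_all add: B_def Metric_space.mspace_metric Metric_space.mdist_metric)
    define A where "A = submetric B (Some ` mspace Y)"
    have A: "mspace A = Some ` mspace Y" "mdist A = d"
      by (auto simp: A_def B M_def)
    have "isometric_embedding A B id" "one_Lipschitz_map A Y the"
      by (auto simp: isometric_embedding_def one_Lipschitz_map_def A B M_def d_def)
    then obtain g where g: "one_Lipschitz_map B Y g" "\<And>a. a \<in> mspace A \<Longrightarrow> g (id a) = the a"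
      using inj unfolding injective_metric_def by blast
    have gN: "g None \<in> mspace Y" using g(1) by (auto simp: one_Lipschitz_map_def B M_def)
    have "mdist Y c (g None) \<le> r" if cr: "(c, r) \<in> K" for c r
    proof -
      have c: "c \<in> mspace Y" using K cr by auto
      have "mdist Y c (g None) = mdist Y (g (Some c)) (g None)"
        using g(2)[of "Some c"] c by (simp add: A)
      also have "\<dots> \<le> d (Some c) None"
        using g(1) c by (simp add: one_Lipschitz_map_def B M_def)
      also have "\<dots> = s c" by (simp add: d_def)
      also have "\<dots> \<le> r" using s_le[OF cr, of c] c by simp
      finally show ?thesis .
    qed
    then show ?thesis using gN by auto
  qed
qed

lemma injective_metric_extend:
  fixes A :: "'a metric" and B :: "'b metric" and Y :: "'y metric"
  assumes inj: "injective_metric Y"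
    and i: "isometric_embedding A B i" and f: "one_Lipschitz_map A Y f"
  shows "\<exists>g. one_Lipschitz_map B Y g \<and> (\<forall>a\<in>mspace A. g (i a) = f a)"
proof -
  interpret Y: Metric_space "mspace Y" "mdist Y" by simp
  interpret B: Metric_space "mspace B" "mdist B" by simp
  define G0 where "G0 = (\<lambda>a. (i a, f a)) ` mspace A"
  define F where "F = {G. G0 \<subseteq> G \<and> G \<subseteq> mspace B \<times> mspace Y \<and>
    (\<forall>(b, y)\<in>G. \<forall>(b', y')\<in>G. mdist Y y y' \<le> mdist B b b')}"
  have "G0 \<in> F"
    using i f by (auto simp: F_def G0_def isometric_embedding_def one_Lipschitz_map_def)
  then have "F \<noteq> {}" by auto
  moreover have "\<Union>C \<in> F" if "C \<noteq> {}" "subset.chain F C" for C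
  proof -
    have C: "C \<subseteq> F" "\<And>G H. G \<in> C \<Longrightarrow> H \<in> C \<Longrightarrow> G \<subseteq> H \<or> H \<subseteq> G"
      using that(2) by (auto simp: subset.chain_def)
    have "mdist Y y y' \<le> mdist B b b'"
      if GH: "(b, y) \<in> G" "G \<in> C" "(b', y') \<in> H" "H \<in> C" for b y b' y' G H
    proof -
      obtain N where "N \<in> C" "(b, y) \<in> N" "(b', y') \<in> N"
        using GH C(2)[of G H] by blast
      then show ?thesis using C(1) by (fastforce simp: F_def)
    qed
    moreover have "G0 \<subseteq> \<Union>C" using C(1) that(1) unfolding F_def by blast
    moreover have "\<Union>C \<subseteq> mspace B \<times> mspace Y" using C(1) unfolding F_def by blast
    ultimately show ?thesis unfolding F_def by auto
  qed
  ultimately obtain G where G: "G \<in> F" and max: "\<And>H. H \<in> F \<Longrightarrow> G \<subseteq> H \<Longrightarrow> H = G"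
    using subset_Zorn_nonempty[of F] by metis
  have GBY: "G \<subseteq> mspace B \<times> mspace Y" and G0: "G0 \<subseteq> G" using G by (auto simp: F_def)
  have Gle: "mdist Y y y' \<le> mdist B b b'" if "(b, y) \<in> G" "(b', y') \<in> G" for b y b' y'
    using G that by (fastforce simp: F_def)
  have dom: "\<exists>y. (b, y) \<in> G" if b: "b \<in> mspace B" for b
  proof -
    define K where "K = (\<lambda>(b', y'). (y', mdist B b b')) ` G"
    have "\<exists>y\<in>mspace Y. \<forall>(c, r)\<in>K. mdist Y c y \<le> r"
    proof (rule injective_metric_balls[OF inj])
      show "K \<subseteq> mspace Y \<times> UNIV" using GBY by (auto simp: K_def)
      fix c r c' r' assume "(c, r) \<in> K" "(c', r') \<in> K"
      then obtain b1 b2 where b12: "(b1, c) \<in> G" "r = mdist B b b1" "(b2, c') \<in> G" "r' = mdist B b b2"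
        by (auto simp: K_def)
      have "mdist Y c c' \<le> mdist B b1 b2" using Gle b12 by blast
      also have "\<dots> \<le> r + r'"
        using B.triangle[of b1 b b2] B.commute[of b1 b] b b12 GBY by auto
      finally show "mdist Y c c' \<le> r + r'" .
    qed
    then obtain y where y: "y \<in> mspace Y" "\<And>b' y'. (b', y') \<in> G \<Longrightarrow> mdist Y y' y \<le> mdist B b b'"
      by (fastforce simp: K_def)
    have "insert (b, y) G \<in> F"
      unfolding F_def using GBY G0 b y Gle
      by (auto simp: B.commute Y.commute)
    then have "insert (b, y) G = G" using max by blast
    then show ?thesis by blast
  qed
  define g where "g b = (SOME y. (b, y) \<in> G)" for b
  have g: "(b, g b) \<in> G" if "b \<in> mspace B" for b
    unfolding g_def by (rule someI_ex) (rule dom[OF that])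
  have "one_Lipschitz_map B Y g"
    using g GBY Gle by (fastforce simp: one_Lipschitz_map_def)
  moreover have "g (i a) = f a" if a: "a \<in> mspace A" for a
  proof -
    have ia: "i a \<in> mspace B" using i a by (auto simp: isometric_embedding_def)
    have fa: "(i a, f a) \<in> G" using G0 a by (auto simp: G0_def)
    have "mdist Y (g (i a)) (f a) \<le> mdist B (i a) (i a)" using Gle g[OF ia] fa by blast
    then have "mdist Y (g (i a)) (f a) = 0" using ia by (simp add: order_antisym)
    moreover have "g (i a) \<in> mspace Y" "f a \<in> mspace Y" using g[OF ia] fa GBY by blast+
    ultimately show ?thesis by simp
  qed
  ultimately show ?thesis by blast
qed

text \<open>
  In the following characterization \<open>'a\<close> and \<open>'b\<close> are arbitrary types large enough to contain a
  copy of \<open>'y option\<close>; the implication from left to right, \<open>injective_metric_extend\<close>, needs no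
  such restriction.
\<close>

theorem injective_metric_iff:
  fixes Y :: "'y metric" and \<phi> :: "'y option \<Rightarrow> 'a" and \<psi> :: "'y option \<Rightarrow> 'b"
  assumes \<phi>: "inj \<phi>" and \<psi>: "inj \<psi>"
  shows "injective_metric Y \<longleftrightarrow>
     (\<forall>(A :: 'a metric) (B :: 'b metric) i f.
        isometric_embedding A B i \<and> one_Lipschitz_map A Y f \<longrightarrow>
        (\<exists>g. one_Lipschitz_map B Y g \<and> (\<forall>a\<in>mspace A. g (i a) = f a)))"
    (is "_ \<longleftrightarrow> ?R")
proof
  show ?R if "injective_metric Y" using injective_metric_extend[OF that] by blast
next
  assume R: ?R
  show "injective_metric Y"
    unfolding injective_metric_def
  proof (intro allI impI, elim conjE)
    fix A B :: "'y option metric" and i f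
    assume i: "isometric_embedding A B i" and f: "one_Lipschitz_map A Y f"
    have copy: "\<exists>N. mspace N = \<theta> ` mspace M \<and> mdist N = (\<lambda>x y. mdist M (inv \<theta> x) (inv \<theta> y))"
      if "inj \<theta>" for M :: "'y option metric" and \<theta> :: "'y option \<Rightarrow> 'c"
    proof -
      interpret M: Metric_space "mspace M" "mdist M" by simp
      have "Metric_space (\<theta> ` mspace M) (\<lambda>x y. mdist M (inv \<theta> x) (inv \<theta> y))"
        using that by unfold_locales (auto simp: M.commute M.triangle)
      then show ?thesis
        by (metis Metric_space.mspace_metric Metric_space.mdist_metric)
    qed
    obtain A' where A': "mspace A' = \<phi> ` mspace A"
      "mdist A' = (\<lambda>x y. mdist A (inv \<phi> x) (inv \<phi> y))" using copy[OF \<phi>] by blast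
    obtain B' where B': "mspace B' = \<psi> ` mspace B"
      "mdist B' = (\<lambda>x y. mdist B (inv \<psi> x) (inv \<psi> y))" using copy[OF \<psi>] by blast
    have "isometric_embedding A' B' (\<psi> \<circ> i \<circ> inv \<phi>)" "one_Lipschitz_map A' Y (f \<circ> inv \<phi>)"
      using i f \<phi> \<psi> by (auto simp: isometric_embedding_def one_Lipschitz_map_def A' B')
    then obtain g where g: "one_Lipschitz_map B' Y g"
      "\<And>a. a \<in> mspace A' \<Longrightarrow> g ((\<psi> \<circ> i \<circ> inv \<phi>) a) = (f \<circ> inv \<phi>) a" using R by blast
    have "one_Lipschitz_map B Y (g \<circ> \<psi>)"
      using g(1) \<psi> by (auto simp: one_Lipschitz_map_def B')
    moreover have "\<forall>a\<in>mspace A. (g \<circ> \<psi>) (i a) = f a"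
      using g(2)[of "\<phi> _"] \<phi> by (simp add: A')
    ultimately show "\<exists>g. one_Lipschitz_map B Y g \<and> (\<forall>a\<in>mspace A. g (i a) = f a)" by blast
  qed
qed

text \<open>The supremum is taken in \<open>[0, \<infinity>]\<close>, so the empty relation has distortion \<open>0\<close>.\<close>

definition distortion :: "'a metric \<Rightarrow> 'b metric \<Rightarrow> ('a \<times> 'b) set \<Rightarrow> ennreal" where
  "distortion X Y R =
     Sup {ennreal \<bar>mdist X x x' - mdist Y y y'\<bar> | x y x' y'. (x, y) \<in> R \<and> (x', y') \<in> R}"

definition strictly_spans :: "'a metric \<Rightarrow> 'a set \<Rightarrow> bool" where
  "strictly_spans X A \<longleftrightarrow> A \<subseteq> mspace X \<and>
     (\<forall>x\<in>mspace X. \<forall>x'\<in>mspace X. \<exists>a\<in>A. mdist X x x' + mdist X x' a = mdist X x a)"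

end

theory Submission
  imports Defs
begin

text \<open>
  Let \<open>D\<close> be the distortion of \<open>R\<close>. If \<open>D = \<infinity>\<close>, every relation containing \<open>R\<close> has the same
  distortion, and \<open>X \<times> Y\<close> is a suitable extension because an injective space is nonempty. If \<open>D < \<infinity>\<close>, Zorn's lemma reduces the claim to adding one point: given \<open>x \<in> X\<close>, find
  \<open>y \<in> Y\<close> with \<open>|xx'| - D \<le> |yy'| \<le> |xx'| + D\<close> for all \<open>(x', y') \<in> R\<close>
  (lemma \<open>one_point_extension\<close>).

  The upper bounds say that \<open>y\<close> lies in the intersection \<open>Z\<close> of certain balls, any two of which have
  centers no farther apart than the sum of their radii, so that \<open>Z\<close> is nonempty by injectivity. Now
  suppose that \<open>y \<in> Z\<close> violates the lower bound at \<open>(x', y')\<close>, and let \<open>(a, b) \<in> R\<close> be such that \<open>x\<close>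
  separates \<open>x'\<close> from \<open>a\<close>, that is, \<open>|x'x| + |xa| = |x'a|\<close>. Then
  \<open>|yb| \<ge> |y'b| - |yy'| > (|x'a| - D) - (|xx'| - D) = |xa|\<close>. Two facts follow:

  \<^item> The lower bound at \<open>(a, b)\<close> holds, so all violations for a given \<open>y\<close> take place in a single
    branch of the tree \<open>X\<close> at \<open>x\<close>.

  \<^item> A point of \<open>Z\<close> with \<open>|yb| \<le> |xa|\<close> has no violation in the branch of \<open>x'\<close>. Such a point exists:
    even if the radius of the ball around \<open>b\<close> is lowered from \<open>|xa| + D\<close> to \<open>|xa|\<close>, any two balls
    satisfy the condition on radii. The strict spanning hypothesis provides the point \<open>a\<close>.

  Start at some \<open>y \<in> Z\<close>, with its violations in one branch, and move inside \<open>Z\<close> along a curve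
  (lemma \<open>injective_metric_curve\<close>) to a point without violations in that branch. To
  violate a lower bound is an open condition, and violations in the starting branch exclude
  violations elsewhere; as an interval is connected, some point of the curve has no violation at all.
\<close>

section \<open>Separation of points in a metric tree\<close>

lemma geodesic_segment_between:
  assumes S: "geodesic_segment X p q S" and x: "x \<in> S"
  shows "mdist X p x + mdist X x q = mdist X p q"
proof -
  obtain \<gamma> where \<gamma>: "isometric_embedding (submetric euclidean_metric {0..mdist X p q}) X \<gamma>"
    "\<gamma> 0 = p" "\<gamma> (mdist X p q) = q" "S = \<gamma> ` {0..mdist X p q}"
    using S by (auto simp: geodesic_segment_def)
  obtain t where t: "t \<in> {0..mdist X p q}" "x = \<gamma> t" using x \<gamma>(4) by blast
  have iso: "mdist X (\<gamma> s) (\<gamma> s') = dist s s'"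
    if "s \<in> {0..mdist X p q}" "s' \<in> {0..mdist X p q}" for s s'
    using \<gamma>(1) that by (auto simp: isometric_embedding_def)
  show ?thesis using iso[of 0 t] iso[of t "mdist X p q"] t \<gamma>(2,3) by (simp add: dist_real_def)
qed

text \<open>Two geodesics that meet at \<open>x\<close> concatenate to a geodesic because no shortcut is possible.\<close>

lemma between_geodesic_segment:
  assumes X: "geodesic_metric X" and pts: "p \<in> mspace X" "x \<in> mspace X" "q \<in> mspace X"
    and btw: "mdist X p x + mdist X x q = mdist X p q"
  shows "\<exists>S. geodesic_segment X p q S \<and> x \<in> S"
proof -
  interpret X: Metric_space "mspace X" "mdist X" by simp
  define a where "a = mdist X p x"
  define b where "b = mdist X x q"
  have ab: "0 \<le> a" "0 \<le> b" "mdist X p q = a + b" using btw by (simp_all add: a_def b_def)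
  obtain \<gamma>1 where \<gamma>1: "isometric_embedding (submetric euclidean_metric {0..a}) X \<gamma>1"
    "\<gamma>1 0 = p" "\<gamma>1 a = x"
    using X pts by (fastforce simp: geodesic_metric_def geodesic_segment_def a_def)
  obtain \<gamma>2 where \<gamma>2: "isometric_embedding (submetric euclidean_metric {0..b}) X \<gamma>2"
    "\<gamma>2 0 = x" "\<gamma>2 b = q"
    using X pts by (fastforce simp: geodesic_metric_def geodesic_segment_def b_def)
  have i1: "\<gamma>1 s \<in> mspace X" "mdist X (\<gamma>1 s) (\<gamma>1 s') = \<bar>s - s'\<bar>"
    if "0 \<le> s" "s \<le> a" "0 \<le> s'" "s' \<le> a" for s s'
    using \<gamma>1(1) that by (auto simp: isometric_embedding_def dist_real_def)
  have i2: "\<gamma>2 s \<in> mspace X" "mdist X (\<gamma>2 s) (\<gamma>2 s') = \<bar>s - s'\<bar>"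
    if "0 \<le> s" "s \<le> b" "0 \<le> s'" "s' \<le> b" for s s'
    using \<gamma>2(1) that by (auto simp: isometric_embedding_def dist_real_def)
  define \<gamma> where "\<gamma> t = (if t \<le> a then \<gamma>1 t else \<gamma>2 (t - a))" for t
  have mem: "\<gamma> t \<in> mspace X" if "0 \<le> t" "t \<le> a + b" for t
    using that i1(1)[of t t] i2(1)[of "t - a" "t - a"] by (auto simp: \<gamma>_def)
  have across: "mdist X (\<gamma>1 s) (\<gamma>2 (t - a)) = t - s"
    if st: "0 \<le> s" "s \<le> a" "a < t" "t \<le> a + b" for s t
  proof -
    have m: "\<gamma>1 s \<in> mspace X" "\<gamma>2 (t - a) \<in> mspace X"
      using i1(1)[of s s] i2(1)[of "t - a" "t - a"] st by auto
    have d: "mdist X p (\<gamma>1 s) = s" "mdist X (\<gamma>1 s) x = a - s"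
      "mdist X x (\<gamma>2 (t - a)) = t - a" "mdist X (\<gamma>2 (t - a)) q = b - (t - a)"
      using i1(2)[of 0 s] i1(2)[of s a] i2(2)[of 0 "t - a"] i2(2)[of "t - a" b] st ab \<gamma>1 \<gamma>2
      by auto
    have "mdist X (\<gamma>1 s) (\<gamma>2 (t - a)) \<le> t - s"
      using X.triangle[of "\<gamma>1 s" x "\<gamma>2 (t - a)"] m pts d by simp
    moreover have "a + b \<le> s + mdist X (\<gamma>1 s) (\<gamma>2 (t - a)) + (b - (t - a))"
      using X.triangle[of p "\<gamma>1 s" q] X.triangle[of "\<gamma>1 s" "\<gamma>2 (t - a)" q] m pts d ab by simp
    ultimately show ?thesis by simp
  qed
  have "mdist X (\<gamma> s) (\<gamma> t) = \<bar>s - t\<bar>" if "0 \<le> s" "s \<le> a + b" "0 \<le> t" "t \<le> a + b" for s t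
    using that i1(2)[of s t] i2(2)[of "s - a" "t - a"] across[of s t] across[of t s]
      X.commute[of "\<gamma>1 t" "\<gamma>2 (s - a)"]
    by (auto simp: \<gamma>_def)
  then have "isometric_embedding (submetric euclidean_metric {0..mdist X p q}) X \<gamma>"
    using mem by (auto simp: isometric_embedding_def dist_real_def ab)
  moreover have "\<gamma> 0 = p" "\<gamma> (mdist X p q) = q" "\<gamma> a = x"
    using ab \<gamma>1 \<gamma>2 by (auto simp: \<gamma>_def)
  ultimately show ?thesis
    unfolding geodesic_segment_def using ab by (intro exI[of _ "\<gamma> ` {0..mdist X p q}"]) force
qed

text \<open>
  A point \<open>x\<close> that separates \<open>p\<close> from \<open>q\<close> lies on a segment \<open>pq\<close>, hence on one of the two other sides of
  a triangle \<open>pqr\<close>. Consequently the relation ``not separated by \<open>x\<close>'' is transitive, and on the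
  points other than \<open>x\<close> it is an equivalence relation; its classes are the branches at \<open>x\<close>.
\<close>

lemma metric_tree_separation:
  assumes X: "metric_tree X"
    and pts: "p \<in> mspace X" "q \<in> mspace X" "r \<in> mspace X" "x \<in> mspace X"
    and btw: "mdist X p x + mdist X x q = mdist X p q"
  shows "mdist X p x + mdist X x r = mdist X p r \<or> mdist X q x + mdist X x r = mdist X q r"
proof -
  have geo: "geodesic_metric X" using X by (simp add: metric_tree_def)
  obtain S where S: "geodesic_segment X p q S" "x \<in> S"
    using between_geodesic_segment[OF geo _ _ _ btw] pts by blast
  obtain S1 S2 where S12: "geodesic_segment X p r S1" "geodesic_segment X q r S2"
    using geo pts by (meson geodesic_metric_def)
  then have "S \<subseteq> S1 \<union> S2"
    using X S(1) pts unfolding metric_tree_def by blast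
  then have "x \<in> S1 \<or> x \<in> S2" using S(2) by blast
  then show ?thesis
    using geodesic_segment_between[OF S12(1)] geodesic_segment_between[OF S12(2)] by blast
qed

section \<open>Curves in injective metric spaces\<close>

text \<open>
  Glue a curve \<open>p\<close> to \<open>Y\<close> by declaring \<open>|p(t)z| = (1 - t) |y\<^sub>0z| + t |y\<^sub>1z|\<close> and
  \<open>|p(s)p(t)| = |s - t| |y\<^sub>0y\<^sub>1|\<close>. This is a metric, and a retraction onto \<open>Y\<close> does not increase these
  distances. The convexity estimate in the conclusion makes the curve stay in every ball that
  contains both endpoints.
\<close>

lemma injective_metric_curve:
  fixes Y :: "'b metric"
  assumes inj: "injective_metric Y" and y: "y0 \<in> mspace Y" "y1 \<in> mspace Y"
  obtains \<gamma> :: "real \<Rightarrow> 'b" where "\<gamma> 0 = y0" "\<gamma> 1 = y1" "\<gamma> \<in> {0..1} \<rightarrow> mspace Y"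
    "\<And>t z. t \<in> {0..1} \<Longrightarrow> z \<in> mspace Y \<Longrightarrow>
       mdist Y (\<gamma> t) z \<le> (1 - t) * mdist Y y0 z + t * mdist Y y1 z"
    "\<And>s t. s \<in> {0..1} \<Longrightarrow> t \<in> {0..1} \<Longrightarrow> mdist Y (\<gamma> s) (\<gamma> t) \<le> \<bar>s - t\<bar> * mdist Y y0 y1"
proof (cases "y0 = y1")
  case True
  interpret Y: Metric_space "mspace Y" "mdist Y" by simp
  show ?thesis by (rule that[of "\<lambda>_. y0"]) (use True y in \<open>auto simp: algebra_simps\<close>)
next
  case False
  interpret Y: Metric_space "mspace Y" "mdist Y" by simp
  define L where "L = mdist Y y0 y1"
  have L: "0 < L" using False y by (simp add: L_def)
  define e where "e t z = (1 - t) * mdist Y y0 z + t * mdist Y y1 z" for t z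
  have e_pos: "0 < e t z" if t: "0 < t" "t < 1" and z: "z \<in> mspace Y" for t z
  proof -
    have "0 < mdist Y y0 z \<or> 0 < mdist Y y1 z" using False y z by auto
    then show ?thesis
      using t Y.nonneg[of y0 z] Y.nonneg[of y1 z] unfolding e_def
      by (metis add_nonneg_pos add_pos_nonneg diff_gt_0_iff_gt less_imp_le mult_nonneg_nonneg mult_pos_pos)
  qed
  have e_lip: "e t z \<le> e t z' + mdist Y z' z"
    if t: "0 \<le> t" "t \<le> 1" and z: "z \<in> mspace Y" "z' \<in> mspace Y" for t z z'
  proof -
    have "(1 - t) * mdist Y y0 z \<le> (1 - t) * (mdist Y y0 z' + mdist Y z' z)"
      "t * mdist Y y1 z \<le> t * (mdist Y y1 z' + mdist Y z' z)"
      using t z y by (auto intro!: mult_left_mono Y.triangle)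
    then show ?thesis unfolding e_def by (simp add: algebra_simps)
  qed
  have e_sum: "mdist Y z z' \<le> e t z + e t z'"
    if t: "0 \<le> t" "t \<le> 1" and z: "z \<in> mspace Y" "z' \<in> mspace Y" for t z z'
  proof -
    have "mdist Y z z' \<le> mdist Y y0 z + mdist Y y0 z'" "mdist Y z z' \<le> mdist Y y1 z + mdist Y y1 z'"
      using Y.triangle[of z y0 z'] Y.triangle[of z y1 z'] Y.commute z y by auto
    then have "(1 - t) * mdist Y z z' \<le> (1 - t) * (mdist Y y0 z + mdist Y y0 z')"
      "t * mdist Y z z' \<le> t * (mdist Y y1 z + mdist Y y1 z')"
      using t by (auto intro!: mult_left_mono)
    then show ?thesis unfolding e_def by (simp add: algebra_simps)
  qed
  have e_par: "e t z \<le> e s z + \<bar>s - t\<bar> * L" if z: "z \<in> mspace Y" for s t z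
  proof -
    have "\<bar>mdist Y y0 z - mdist Y y1 z\<bar> \<le> L"
      using Y.triangle[of y0 y1 z] Y.triangle[of y1 y0 z] Y.commute[of y1 y0] z y by (auto simp: L_def)
    then have "\<bar>s - t\<bar> * \<bar>mdist Y y0 z - mdist Y y1 z\<bar> \<le> \<bar>s - t\<bar> * L" by (simp add: mult_left_mono)
    moreover have "e t z - e s z = (s - t) * (mdist Y y0 z - mdist Y y1 z)"
      unfolding e_def by (simp add: algebra_simps)
    ultimately show ?thesis
      using abs_ge_self[of "(s - t) * (mdist Y y0 z - mdist Y y1 z)"] by (simp add: abs_mult)
  qed
  have e_len: "\<bar>s - t\<bar> * L \<le> e s z + e t z"
    if st: "0 \<le> s" "s \<le> 1" "0 \<le> t" "t \<le> 1" and z: "z \<in> mspace Y" for s t z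
  proof -
    have "L \<le> mdist Y y0 z + mdist Y y1 z"
      unfolding L_def using Y.triangle[of y0 z y1] Y.commute[of z y1] z y by auto
    then have "\<bar>s - t\<bar> * L \<le> \<bar>s - t\<bar> * (mdist Y y0 z + mdist Y y1 z)" by (simp add: mult_left_mono)
    also have "\<dots> \<le> (2 - s - t) * mdist Y y0 z + (s + t) * mdist Y y1 z"
      unfolding distrib_left using st by (intro add_mono mult_right_mono) auto
    finally show ?thesis unfolding e_def by (simp add: algebra_simps)
  qed
  define d where "d p q = (case (p, q) of (Inl z, Inl z') \<Rightarrow> mdist Y z z'
    | (Inl z, Inr t) \<Rightarrow> \<bar>e t z\<bar> | (Inr t, Inl z) \<Rightarrow> \<bar>e t z\<bar> | (Inr s, Inr t) \<Rightarrow> \<bar>s - t\<bar> * L)" for p q :: "'b + real"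
  \<comment> \<open>The absolute values make \<open>d\<close> nonnegative on the whole type, not just on \<open>M\<close>.\<close>
  \<comment> \<open>The parameters \<open>0\<close> and \<open>1\<close> are left out: their points would have distance \<open>0\<close> from \<open>y0\<close> and \<open>y1\<close>.\<close>
  define M where "M = Inl ` mspace Y \<union> Inr ` {0<..<1 :: real}"
  have MS: "Metric_space M d"
  proof
    show "0 \<le> d x y" for x y
      using L by (auto simp: d_def split: sum.splits)
    show "d x y = d y x" for x y
      by (auto simp: d_def Y.commute abs_minus_commute split: sum.splits)
    show "d x y = 0 \<longleftrightarrow> x = y" if "x \<in> M" "y \<in> M" for x y
    proof -
      have "e t u \<noteq> 0" if "0 < t" "t < 1" "u \<in> mspace Y" for t u
        using e_pos[OF that] by simp
      then show ?thesis using that L by (auto simp: d_def M_def)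
    qed
    show "d x z \<le> d x y + d y z" if xyz: "x \<in> M" "y \<in> M" "z \<in> M" for x y z
    proof -
      have len: "\<bar>t - r\<bar> * L \<le> \<bar>t - s\<bar> * L + \<bar>s - r\<bar> * L" for r s t
        unfolding distrib_right[symmetric] using L by (intro mult_right_mono) auto
      have e_abs: "\<bar>e t u\<bar> = e t u" if "0 < t" "t < 1" "u \<in> mspace Y" for t u
        using e_pos[OF that] by simp
      have e_lip': "e t u \<le> mdist Y u v + e t v"
        if "0 \<le> t" "t \<le> 1" "u \<in> mspace Y" "v \<in> mspace Y" for t u v
        using e_lip[OF that] Y.commute[of u v] by simp
      have e_par': "e t u \<le> \<bar>t - s\<bar> * L + e s u" if "u \<in> mspace Y" for s t u
        using e_par[OF that, of t s] by (simp add: abs_minus_commute)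
      show ?thesis
        using xyz len
        by (auto simp: d_def M_def e_abs Y.triangle e_sum e_len e_lip e_lip' e_par e_par')
    qed
  qed
  define B where "B = metric (M, d)"
  have B: "mspace B = M" "mdist B = d"
    using MS by (simp_all add: B_def Metric_space.mspace_metric Metric_space.mdist_metric)
  have "isometric_embedding Y B Inl" "one_Lipschitz_map Y Y id"
    by (auto simp: isometric_embedding_def one_Lipschitz_map_def B M_def d_def)
  then obtain g where g: "one_Lipschitz_map B Y g" "\<And>z. z \<in> mspace Y \<Longrightarrow> g (Inl z) = z"
    using injective_metric_extend[OF inj, of Y B Inl id] by auto
  have gY: "g (Inr t) \<in> mspace Y" if "0 < t" "t < 1" for t
    using g(1) that by (auto simp: one_Lipschitz_map_def B M_def)
  have g_e: "mdist Y (g (Inr t)) z \<le> e t z" if "0 < t" "t < 1" "z \<in> mspace Y" for t z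
  proof -
    have "mdist Y (g (Inr t)) (g (Inl z)) \<le> d (Inr t) (Inl z)"
      using g(1) that by (simp add: one_Lipschitz_map_def B M_def)
    then show ?thesis using g(2) that e_pos[OF that] by (simp add: d_def)
  qed
  have g_len: "mdist Y (g (Inr s)) (g (Inr t)) \<le> \<bar>s - t\<bar> * L"
    if "0 < s" "s < 1" "0 < t" "t < 1" for s t
  proof -
    have "mdist Y (g (Inr s)) (g (Inr t)) \<le> d (Inr s) (Inr t)"
      using g(1) that by (simp add: one_Lipschitz_map_def B M_def)
    then show ?thesis by (simp add: d_def)
  qed
  define \<gamma> where "\<gamma> t = (if t = 0 then y0 else if t = 1 then y1 else g (Inr t))" for t
  have \<gamma>Y: "\<gamma> t \<in> mspace Y" if "t \<in> {0..1}" for t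
    using gY that y by (auto simp: \<gamma>_def)
  have \<gamma>_e: "mdist Y (\<gamma> t) z \<le> e t z" if "t \<in> {0..1}" "z \<in> mspace Y" for t z
    using g_e[of t z] that by (auto simp: \<gamma>_def e_def)
  have e_end: "e t y0 = t * L" "e t y1 = (1 - t) * L" for t
    using y Y.commute[of y1 y0] by (simp_all add: e_def L_def)
  have \<gamma>_len: "mdist Y (\<gamma> s) (\<gamma> t) \<le> \<bar>s - t\<bar> * L" if st: "s \<in> {0..1}" "t \<in> {0..1}" for s t
  proof -
    have end_len: "mdist Y (\<gamma> r) (\<gamma> r') \<le> \<bar>r - r'\<bar> * L"
      if "r \<in> {0..1}" "r' = 0 \<or> r' = 1" for r r'
      using that \<gamma>_e[of r y0] \<gamma>_e[of r y1] y e_end[of r] by (auto simp: \<gamma>_def[of r'])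
    consider "s = 0 \<or> s = 1" | "t = 0 \<or> t = 1" | "0 < s" "s < 1" "0 < t" "t < 1"
      using st by fastforce
    then show ?thesis
    proof cases
      case 1
      then show ?thesis using end_len[OF st(2)] Y.commute abs_minus_commute by metis
    next
      case 2
      then show ?thesis using end_len[OF st(1)] by blast
    next
      case 3
      then show ?thesis using g_len by (auto simp: \<gamma>_def)
    qed
  qed
  show ?thesis
    by (rule that[of \<gamma>]) (use \<gamma>Y \<gamma>_e \<gamma>_len in \<open>auto simp: \<gamma>_def[of 0] \<gamma>_def[of 1] e_def L_def\<close>)
qed

section \<open>Adding points to the relation\<close>

text \<open>
  This is an intermediate value argument. Along a curve of points that satisfy the upper bounds, a
  lower bound can fail inside the branch of a fixed point \<open>p0\<close> or outside of it, but for no parameter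
  in both ways. The curve starts with a failure inside and ends without one, so the two relatively
  open sets of parameters cannot cover the interval.
\<close>

lemma one_point_extension:
  fixes X :: "'a metric" and Y :: "'b metric"
  assumes X: "metric_tree X" and Y: "injective_metric Y"
    and R: "R \<subseteq> mspace X \<times> mspace Y" and span: "strictly_spans X (fst ` R)"
    and D: "0 \<le> D"
    and dis: "\<And>p q p' q'. (p, q) \<in> R \<Longrightarrow> (p', q') \<in> R \<Longrightarrow> \<bar>mdist X p p' - mdist Y q q'\<bar> \<le> D"
    and x: "x \<in> mspace X"
  shows "\<exists>y\<in>mspace Y. \<forall>(p, q)\<in>R. \<bar>mdist X x p - mdist Y y q\<bar> \<le> D"
proof -
  interpret X: Metric_space "mspace X" "mdist X" by simp
  interpret Y: Metric_space "mspace Y" "mdist Y" by simp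
  define sep where "sep p q \<longleftrightarrow> mdist X p x + mdist X x q = mdist X p q" for p q
  define Z where "Z = {y \<in> mspace Y. \<forall>(p, q)\<in>R. mdist Y y q \<le> mdist X x p + D}"
  define bad where "bad y p q \<longleftrightarrow> mdist Y y q < mdist X x p - D" for y p q
  have RX: "p \<in> mspace X" "q \<in> mspace Y" if "(p, q) \<in> R" for p q using R that by auto
  have sep_sym: "sep p q = sep q p" for p q by (simp add: sep_def X.commute add.commute)
  have sep_bad: "mdist X x a < mdist Y y b"
    if "(p, q) \<in> R" "(a, b) \<in> R" "sep p a" "bad y p q" "y \<in> mspace Y" for p q a b y
    using dis[OF that(1,2)] Y.triangle[of q y b] that RX Y.commute[of q y] X.commute[of p x]
    by (force simp: sep_def bad_def)
  have good: "\<exists>y\<in>mspace Y. \<forall>(p, q)\<in>R. \<bar>mdist X x p - mdist Y y q\<bar> \<le> D"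
    if "y \<in> Z" "\<And>p q. (p, q) \<in> R \<Longrightarrow> \<not> bad y p q" for y
    using that by (intro bexI[of _ y]) (force simp: Z_def bad_def)+
  have tri: "mdist Y q q' \<le> mdist X x p + mdist X x p' + D" if "(p, q) \<in> R" "(p', q') \<in> R" for p q p' q'
    using dis[OF that] X.triangle[of p x p'] X.commute[of p x] RX[OF that(1)] RX[OF that(2)] x by auto
  have "\<exists>y\<in>mspace Y. \<forall>(c, r)\<in>(\<lambda>(p, q). (q, mdist X x p + D)) ` R. mdist Y c y \<le> r"
    by (rule injective_metric_balls[OF Y]) (use RX tri D in \<open>force+\<close>)
  then obtain y0 where y0: "y0 \<in> Z" by (fastforce simp: Z_def Y.commute)
  show ?thesis
  proof (cases "\<exists>(p, q)\<in>R. bad y0 p q")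
    case False
    then show ?thesis using good[OF y0] by blast
  next
    case True
    then obtain p0 q0 where p0: "(p0, q0) \<in> R" "bad y0 p0 q0" by blast
    \<comment> \<open>Strict spanning continues the segment from \<open>p0\<close> to \<open>x\<close> up to a point of the domain of \<open>R\<close>.\<close>
    obtain a b where ab: "(a, b) \<in> R" "sep p0 a"
      using span x RX[OF p0(1)] by (force simp: strictly_spans_def sep_def)
    \<comment> \<open>Lowering the radius at the single point \<open>b\<close> is harmless: a pair of balls needs just one summand
      \<open>D\<close>, and \<open>b\<close> paired with itself needs none.\<close>
    have "\<exists>y\<in>mspace Y. \<forall>(c, r)\<in>insert (b, mdist X x a) ((\<lambda>(p, q). (q, mdist X x p + D)) ` R).
        mdist Y c y \<le> r"
    proof (rule injective_metric_balls[OF Y])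
      show "insert (b, mdist X x a) ((\<lambda>(p, q). (q, mdist X x p + D)) ` R) \<subseteq> mspace Y \<times> UNIV"
        using RX ab by auto
      show "mdist Y c c' \<le> r + r'"
        if "(c, r) \<in> insert (b, mdist X x a) ((\<lambda>(p, q). (q, mdist X x p + D)) ` R)"
          "(c', r') \<in> insert (b, mdist X x a) ((\<lambda>(p, q). (q, mdist X x p + D)) ` R)" for c r c' r'
        using that tri D tri[OF ab(1)] tri[OF _ ab(1)] RX[OF ab(1)] by (force simp: add.commute add.left_commute)
    qed
    then obtain y1 where y1: "y1 \<in> Z" "mdist Y y1 b \<le> mdist X x a"
      by (fastforce simp: Z_def Y.commute)
    obtain \<gamma> where \<gamma>: "\<gamma> 0 = y0" "\<gamma> 1 = y1" "\<gamma> \<in> {0..1} \<rightarrow> mspace Y"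
      and cvx: "\<And>t z. t \<in> {0..1} \<Longrightarrow> z \<in> mspace Y \<Longrightarrow>
         mdist Y (\<gamma> t) z \<le> (1 - t) * mdist Y y0 z + t * mdist Y y1 z"
      and lip: "\<And>s t. s \<in> {0..1} \<Longrightarrow> t \<in> {0..1} \<Longrightarrow> mdist Y (\<gamma> s) (\<gamma> t) \<le> \<bar>s - t\<bar> * mdist Y y0 y1"
      using injective_metric_curve[OF Y] y0 y1 unfolding Z_def by (metis (no_types, lifting) mem_Collect_eq)
    have \<gamma>Z: "\<gamma> t \<in> Z" if t: "t \<in> {0..1}" for t
    proof -
      have "mdist Y (\<gamma> t) q \<le> mdist X x p + D" if pq: "(p, q) \<in> R" for p q
      proof -
        have "mdist Y (\<gamma> t) q \<le> (1 - t) * mdist Y y0 q + t * mdist Y y1 q"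
          using cvx[OF t] RX[OF pq] by blast
        also have "\<dots> \<le> mdist X x p + D"
          by (rule convex_bound_le) (use t y0 y1(1) pq in \<open>auto simp: Z_def\<close>)
        finally show ?thesis .
      qed
      then show ?thesis using \<gamma>(3) t by (auto simp: Z_def)
    qed
    have cont: "continuous_on {0..1} (\<lambda>t. mdist Y (\<gamma> t) q)" if q: "q \<in> mspace Y" for q
    proof (rule lipschitz_on_continuous_on)
      show "(mdist Y y0 y1)-lipschitz_on {0..1} (\<lambda>t. mdist Y (\<gamma> t) q)"
      proof (rule lipschitz_onI)
        fix s t :: real assume st: "s \<in> {0..1}" "t \<in> {0..1}"
        then have m: "\<gamma> s \<in> mspace Y" "\<gamma> t \<in> mspace Y" using \<gamma>(3) by auto
        have "\<bar>mdist Y (\<gamma> s) q - mdist Y (\<gamma> t) q\<bar> \<le> mdist Y (\<gamma> s) (\<gamma> t)"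
          using Y.triangle[of "\<gamma> s" "\<gamma> t" q] Y.triangle[of "\<gamma> t" "\<gamma> s" q] Y.commute[of "\<gamma> s" "\<gamma> t"] m q
          by auto
        then show "dist (mdist Y (\<gamma> s) q) (mdist Y (\<gamma> t) q) \<le> mdist Y y0 y1 * dist s t"
          using lip[OF st] by (simp add: dist_real_def mult.commute)
      qed simp
    qed
    define viol where "viol P = {t \<in> {0..1}. \<exists>(p, q)\<in>R. P p \<and> bad (\<gamma> t) p q}" for P
    have op: "openin (top_of_set {0..1}) (viol P)" for P
    proof -
      have "viol P = (\<Union>(p, q)\<in>{(p, q) \<in> R. P p}.
          {0..1} \<inter> (\<lambda>t. mdist Y (\<gamma> t) q) -` {..<mdist X x p - D})"
        by (auto simp: viol_def bad_def)
      moreover have "openin (top_of_set {0..1}) ({0..1} \<inter> (\<lambda>t. mdist Y (\<gamma> t) q) -` {..<mdist X x p - D})"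
        if "(p, q) \<in> R" for p q
        by (rule continuous_openin_preimage_gen[OF cont]) (use RX[OF that] in auto)
      ultimately show ?thesis by (auto intro!: openin_Union)
    qed
    \<comment> \<open>The branch of \<open>p0\<close> consists of the points \<open>p\<close> with \<open>\<not> sep p0 p\<close>.\<close>
    have branch: "sep p p'" if "(p, q) \<in> R" "(p', q') \<in> R" "\<not> sep p0 p" "sep p0 p'" for p q p' q'
      using metric_tree_separation[OF X, of p0 p' p x] that RX p0(1) x
      by (metis sep_def sep_sym)
    have disj: "viol (\<lambda>p. \<not> sep p0 p) \<inter> viol (sep p0) = {}"
    proof (rule ccontr)
      assume "\<not> ?thesis"
      then obtain t where t: "t \<in> viol (\<lambda>p. \<not> sep p0 p)" "t \<in> viol (sep p0)" by blast
      obtain p q where pq: "(p, q) \<in> R" "\<not> sep p0 p" "bad (\<gamma> t) p q"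
        using t(1) by (auto simp: viol_def)
      obtain p' q' where pq': "(p', q') \<in> R" "sep p0 p'" "bad (\<gamma> t) p' q'"
        using t(2) by (auto simp: viol_def)
      have "\<gamma> t \<in> mspace Y" using t(1) \<gamma>(3) by (auto simp: viol_def)
      have "mdist X x p' < mdist Y (\<gamma> t) q'"
        using sep_bad[OF pq(1) pq'(1) branch[OF pq(1) pq'(1) pq(2) pq'(2)] pq(3)] \<open>\<gamma> t \<in> mspace Y\<close> .
      then show False using pq'(3) D by (simp add: bad_def)
    qed
    have "p0 \<in> mspace X" using RX p0 by blast
    \<comment> \<open>Only \<open>x\<close> itself is separated from itself by \<open>x\<close>, and a violated lower bound forces \<open>|xp0| > D\<close>.\<close>
    have "\<not> sep p0 p0"
    proof
      assume "sep p0 p0"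
      then have "mdist X x p0 = 0" using X.commute[of x p0] \<open>p0 \<in> mspace X\<close> by (simp add: sep_def)
      then show False using p0(2) D Y.nonneg[of y0 q0] by (simp add: bad_def)
    qed
    then have in0: "0 \<in> viol (\<lambda>p. \<not> sep p0 p)" using p0 \<gamma>(1) by (auto simp: viol_def)
    have in1: "1 \<notin> viol (\<lambda>p. \<not> sep p0 p)"
    proof
      assume "1 \<in> viol (\<lambda>p. \<not> sep p0 p)"
      then obtain p q where pq: "(p, q) \<in> R" "\<not> sep p0 p" "bad y1 p q" by (auto simp: viol_def \<gamma>(2))
      then show False
        using sep_bad[OF pq(1) ab(1) branch[OF pq(1) ab(1) pq(2) ab(2)] pq(3)] y1 by (simp add: Z_def)
    qed
    have "\<exists>t\<in>{0..1}. t \<notin> viol (\<lambda>p. \<not> sep p0 p) \<and> t \<notin> viol (sep p0)"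
    proof (rule ccontr)
      assume "\<not> ?thesis"
      then have "{0..1} \<subseteq> viol (\<lambda>p. \<not> sep p0 p) \<union> viol (sep p0)" by blast
      moreover from this have "1 \<in> viol (sep p0)" using in1 by (meson Un_iff atLeastAtMost_iff order_refl subsetD zero_le_one)
      ultimately show False
        using connected_Icc[of 0 "1::real"] op[of "\<lambda>p. \<not> sep p0 p"] op[of "sep p0"] disj in0
        unfolding connected_openin by (metis empty_iff)
    qed
    then obtain t where t: "t \<in> {0..1}" "t \<notin> viol (\<lambda>p. \<not> sep p0 p)" "t \<notin> viol (sep p0)" by blast
    have "\<not> bad (\<gamma> t) p q" if "(p, q) \<in> R" for p q
      using t that by (auto simp: viol_def)
    then show ?thesis using good[OF \<gamma>Z[OF t(1)]] by blast
  qed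
qed

theorem proposition2p2:
  fixes X :: "'a metric" and Y :: "'b metric" and R :: "('a \<times> 'b) set"
  assumes "metric_tree X"
    and "injective_metric Y"
    and "R \<subseteq> mspace X \<times> mspace Y"
    and "strictly_spans X (fst ` R)"
  shows "\<exists>R'. R \<subseteq> R' \<and> R' \<subseteq> mspace X \<times> mspace Y \<and>
           fst ` R' = mspace X \<and> distortion X Y R' = distortion X Y R"
proof -
  interpret X: Metric_space "mspace X" "mdist X" by simp
  interpret Y: Metric_space "mspace Y" "mdist Y" by simp
  have mono: "distortion X Y R \<le> distortion X Y R'" if "R \<subseteq> R'" for R'
    unfolding distortion_def by (rule Sup_subset_mono) (use that in blast)
  show ?thesis
  proof (cases "distortion X Y R = top")
    case True
    then show ?thesis
      using mono[OF assms(3)] injective_metric_nonempty[OF assms(2)] assms(3)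
      by (intro exI[of _ "mspace X \<times> mspace Y"]) (auto simp: top_unique)
  next
    case False
    define D where "D = enn2real (distortion X Y R)"
    have D: "0 \<le> D" "distortion X Y R = ennreal D"
      using False by (simp_all add: D_def less_top)
    have dis_iff: "distortion X Y G \<le> ennreal D \<longleftrightarrow>
        (\<forall>(p, q)\<in>G. \<forall>(p', q')\<in>G. \<bar>mdist X p p' - mdist Y q q'\<bar> \<le> D)" for G
      using D(1) by (fastforce simp: distortion_def Sup_le_iff)
    define F where "F = {G. R \<subseteq> G \<and> G \<subseteq> mspace X \<times> mspace Y \<and>
      (\<forall>(p, q)\<in>G. \<forall>(p', q')\<in>G. \<bar>mdist X p p' - mdist Y q q'\<bar> \<le> D)}"
    have "R \<in> F" using assms(3) dis_iff[of R] D(2) by (simp add: F_def)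
    moreover have "\<Union>C \<in> F" if "C \<noteq> {}" "subset.chain F C" for C
    proof -
      have C: "C \<subseteq> F" "\<And>G H. G \<in> C \<Longrightarrow> H \<in> C \<Longrightarrow> G \<subseteq> H \<or> H \<subseteq> G"
        using that(2) by (auto simp: subset.chain_def)
      have "\<bar>mdist X p p' - mdist Y q q'\<bar> \<le> D"
        if GH: "(p, q) \<in> G" "G \<in> C" "(p', q') \<in> H" "H \<in> C" for p q p' q' G H
      proof -
        obtain N where "N \<in> C" "(p, q) \<in> N" "(p', q') \<in> N" using GH C(2)[of G H] by blast
        then show ?thesis using C(1) by (fastforce simp: F_def)
      qed
      moreover have "R \<subseteq> \<Union>C" using C(1) that(1) unfolding F_def by blast
      moreover have "\<Union>C \<subseteq> mspace X \<times> mspace Y" using C(1) unfolding F_def by blast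
      ultimately show ?thesis unfolding F_def by auto
    qed
    ultimately obtain G where G: "G \<in> F" and max: "\<And>H. H \<in> F \<Longrightarrow> G \<subseteq> H \<Longrightarrow> H = G"
      using subset_Zorn_nonempty[of F] by (metis empty_iff)
    have RG: "R \<subseteq> G" and GXY: "G \<subseteq> mspace X \<times> mspace Y" using G by (auto simp: F_def)
    have dis: "\<bar>mdist X p p' - mdist Y q q'\<bar> \<le> D" if "(p, q) \<in> G" "(p', q') \<in> G" for p q p' q'
      using G that by (fastforce simp: F_def)
    have "fst ` R \<subseteq> fst ` G" "fst ` G \<subseteq> mspace X" using RG GXY by auto
    then have span: "strictly_spans X (fst ` G)"
      using assms(4) unfolding strictly_spans_def by (meson subsetD)
    have "x \<in> fst ` G" if x: "x \<in> mspace X" for x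
    proof -
      have "\<exists>y\<in>mspace Y. \<forall>(p, q)\<in>G. \<bar>mdist X x p - mdist Y y q\<bar> \<le> D"
        by (rule one_point_extension[OF assms(1,2) GXY span D(1) _ x]) (rule dis)
      then obtain y where y: "y \<in> mspace Y" "\<And>p q. (p, q) \<in> G \<Longrightarrow> \<bar>mdist X x p - mdist Y y q\<bar> \<le> D"
        by blast
      have "\<bar>mdist X p x - mdist Y q y\<bar> \<le> D" if "(p, q) \<in> G" for p q
        using y(2)[OF that] X.commute Y.commute by metis
      then have "insert (x, y) G \<in> F"
        unfolding F_def using RG GXY x y dis D(1) by auto
      then have "insert (x, y) G = G" using max by blast
      then show ?thesis by force
    qed
    then have "fst ` G = mspace X" using GXY by auto
    moreover have "distortion X Y G \<le> distortion X Y R"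
      unfolding D(2) dis_iff using dis by blast
    ultimately show ?thesis using RG GXY mono[OF RG] by (auto intro: order_antisym)
  qed
qed

end
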